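(* Let $X$ be an arbitrary gd-set (no closure of its function family under maximum, minimum, truncation, postcomposition by $1$-Lipschitz maps or inf-convolution is assumed, and neither constant functions nor the zero function are assumed to belong to $\overline{F_X}$). Then the following hold. (i) If $0<\kappa<1/2$, then $\operatorname{ObsDiam}(X;-2\kappa)\le\operatorname{Sep}^+(X;\kappa,\kappa)$. (ii) If $0<\kappa'<\kappa\le1/2$, then $\operatorname{Sep}^+(X;\kappa,\kappa)\le\operatorname{ObsDiam}(X;-\kappa')$. (iii) If $0<\kappa<1$ and $r_+,r_->0$ satisfy $\alpha_X^+(r_+)+\alpha_X^-(r_-)\le\kappa$, then $\operatorname{ObsDiam}(X;-\kappa)\le r_++r_-$. (iv) For every $r>0$, $$\max\{\alpha_X^+(r),\alpha_X^-(r)\}\le\sup\{\kappa\in(0,1)\mid\operatorname{ObsDiam}(X;-\kappa)\ge r\},$$ where the supremum on the right is understood to be $0$ if the set is empty.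
   Context: A gd-set is a triple $(X,F_X,\mu_X)$, written $X$, where $F_X$ is a nonempty family of functions $X\to\mathbb R$ such that $d_{F_X}(x,x')=\sup_{f\in F_X}|f(x)-f(x')|$ is a complete separable metric on $X$, and $\mu_X$ is a Borel probability measure on $(X,d_{F_X})$ with full support. $\overline{F_X}$ is the pointwise closure of $F_X$ in $\mathbb R^X$. For a Borel probability measure $\nu$ on $\mathbb R$ and $\alpha\in(0,1)$, $\operatorname{PartDiam}(\nu;\alpha)=\inf\{\operatorname{diam}B\mid B\subset\mathbb R\text{ Borel},\ \nu(B)\ge\alpha\}$. For $\kappa\in(0,1)$, $\operatorname{ObsDiam}(X;-\kappa)=\sup_{f\in\overline{F_X}}\operatorname{PartDiam}(f_*\mu_X;1-\kappa)$. For nonempty $A,B\subset X$, $\sigma^{\to}(X;A,B)=\sup_{f\in\overline{F_X}}\inf_{a\in A,b\in B}(f(b)-f(a))$. For $\kappa_0,\kappa_1\in(0,1)$, $\operatorname{Sep}(X;\kappa_0,\kappa_1)$ is the supremum of $\sigma^{\to}(X;A_0,A_1)$ over all pairs $(A_0,A_1)$ of disjoint Borel subsets of $X$ with $\mu_X(A_i)\ge\kappa_i$ $(i=0,1)$; it is $0$ if there is no such pair. It may be negative; $\operatorname{Sep}^+(X;\kappa_0,\kappa_1)=\max\{0,\operatorname{Sep}(X;\kappa_0,\kappa_1)\}$. For $f\in\overline{F_X}$, $\operatorname{Med}(f)=\{m\in\mathbb R\mid\mu_X(f\le m)\ge1/2,\ \mu_X(f\ge m)\ge1/2\}$. For $r>0$,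 $$\alpha_X^+(r)=\sup_{f\in\overline{F_X}}\sup_{m\in\operatorname{Med}(f)}\mu_X(f\ge m+r),\qquad\alpha_X^-(r)=\sup_{f\in\overline{F_X}}\sup_{m\in\operatorname{Med}(f)}\mu_X(f\le m-r).$$ *)

theory Defs
  imports "HOL-Analysis.Analysis" "HOL-Probability.Probability"
begin

text \<open>
  A gd-set is given by a carrier set \<open>X\<close>, a family \<open>F\<close> of functions on \<open>X\<close> and a measure \<open>\<mu>\<close>.
  A function \<open>X \<rightarrow> \<real>\<close> is an element of \<open>X \<rightarrow>\<^sub>E UNIV\<close>, that is, it takes the value
  \<open>undefined\<close> outside \<open>X\<close>; thus \<open>X \<rightarrow>\<^sub>E UNIV\<close> stands for \<open>\<real>\<^sup>X\<close> and is the underlying set of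
  \<open>powertop_real X\<close>.  Suprema and infima are taken in \<open>ereal\<close>, as the diameters and
  separation distances below may be infinite.
\<close>

text \<open>
  The case distinction is needed because \<^term>\<open>Metric_space\<close> requires nonnegativity also
  outside the carrier.  The supremum is a real one; its finiteness is part of
  the definition of a gd-set.
\<close>

definition gd_dist :: "'a set \<Rightarrow> ('a \<Rightarrow> real) set \<Rightarrow> 'a \<Rightarrow> 'a \<Rightarrow> real" where
  "gd_dist X F x y = (if x \<in> X \<and> y \<in> X then (SUP f\<in>F. \<bar>f x - f y\<bar>) else 0)"

abbreviation gd_topology :: "'a set \<Rightarrow> ('a \<Rightarrow> real) set \<Rightarrow> 'a topology" where
  "gd_topology X F \<equiv> Metric_space.mtopology X (gd_dist X F)"

definition gd_set :: "'a set \<Rightarrow> ('a \<Rightarrow> real) set \<Rightarrow> 'a measure \<Rightarrow> bool" where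
  "gd_set X F \<mu> \<longleftrightarrow>
     F \<noteq> {} \<and> F \<subseteq> (X \<rightarrow>\<^sub>E UNIV) \<and>
     (\<forall>x\<in>X. \<forall>y\<in>X. bdd_above ((\<lambda>f. \<bar>f x - f y\<bar>) ` F)) \<and>
     Metric_space X (gd_dist X F) \<and>
     Metric_space.mcomplete X (gd_dist X F) \<and>
     separable_space (gd_topology X F) \<and>
     space \<mu> = X \<and> sets \<mu> = sigma_sets X {U. openin (gd_topology X F) U} \<and>
     prob_space \<mu> \<and>
     (\<forall>U. openin (gd_topology X F) U \<and> U \<noteq> {} \<longrightarrow> 0 < measure \<mu> U)"

definition pclosure :: "'a set \<Rightarrow> ('a \<Rightarrow> real) set \<Rightarrow> ('a \<Rightarrow> real) set" where
  "pclosure X F = powertop_real X closure_of F"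

text \<open>The supremum with the convention that the supremum of the empty set is \<open>0\<close>
  (whereas \<open>Sup {} = -\<infinity>\<close> in \<open>ereal\<close>).\<close>

definition Sup0 :: "ereal set \<Rightarrow> ereal" where
  "Sup0 S = (if S = {} then 0 else Sup S)"

text \<open>The library's \<^const>\<open>diameter\<close> is \<open>0\<close> on unbounded sets, so it cannot be used here.\<close>

definition ediam :: "real set \<Rightarrow> ereal" where
  "ediam B = Sup0 {ereal \<bar>x - y\<bar> | x y. x \<in> B \<and> y \<in> B}"

definition PartDiam :: "real measure \<Rightarrow> real \<Rightarrow> ereal" where
  "PartDiam \<nu> \<alpha> = (INF B\<in>{B \<in> sets borel. \<alpha> \<le> measure \<nu> B}. ediam B)"

text \<open>\<open>ObsDiam X F \<mu> \<kappa>\<close> is what is usually written \<open>ObsDiam(X;-\<kappa>)\<close>.  Elements of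
  \<^term>\<open>pclosure X F\<close> are 1-Lipschitz for \<^term>\<open>gd_dist X F\<close>, hence Borel measurable, so that
  \<open>distr \<mu> borel f\<close> is the push-forward \<open>f\<^sub>*\<mu>\<close>.\<close>

definition ObsDiam :: "'a set \<Rightarrow> ('a \<Rightarrow> real) set \<Rightarrow> 'a measure \<Rightarrow> real \<Rightarrow> ereal" where
  "ObsDiam X F \<mu> \<kappa> = (SUP f\<in>pclosure X F. PartDiam (distr \<mu> borel f) (1 - \<kappa>))"

definition directed_sep :: "'a set \<Rightarrow> ('a \<Rightarrow> real) set \<Rightarrow> 'a set \<Rightarrow> 'a set \<Rightarrow> ereal" where
  "directed_sep X F A B = (SUP f\<in>pclosure X F. INF a\<in>A. INF b\<in>B. ereal (f b - f a))"

definition Sep :: "'a set \<Rightarrow> ('a \<Rightarrow> real) set \<Rightarrow> 'a measure \<Rightarrow> real \<Rightarrow> real \<Rightarrow> ereal" where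
  "Sep X F \<mu> \<kappa>0 \<kappa>1 =
     Sup0 {directed_sep X F A0 A1 | A0 A1.
             A0 \<in> sets \<mu> \<and> A1 \<in> sets \<mu> \<and> A0 \<inter> A1 = {} \<and>
             \<kappa>0 \<le> measure \<mu> A0 \<and> \<kappa>1 \<le> measure \<mu> A1}"

definition Sep_plus :: "'a set \<Rightarrow> ('a \<Rightarrow> real) set \<Rightarrow> 'a measure \<Rightarrow> real \<Rightarrow> real \<Rightarrow> ereal" where
  "Sep_plus X F \<mu> \<kappa>0 \<kappa>1 = max 0 (Sep X F \<mu> \<kappa>0 \<kappa>1)"

definition Med :: "'a set \<Rightarrow> 'a measure \<Rightarrow> ('a \<Rightarrow> real) \<Rightarrow> real set" where
  "Med X \<mu> f = {m. 1/2 \<le> measure \<mu> {x\<in>X. f x \<le> m} \<and> 1/2 \<le> measure \<mu> {x\<in>X. m \<le> f x}}"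

text \<open>For a gd-set, \<^term>\<open>pclosure X F\<close> and the sets of medians are nonempty, so the following
  suprema lie in the unit interval.\<close>

definition alpha_plus :: "'a set \<Rightarrow> ('a \<Rightarrow> real) set \<Rightarrow> 'a measure \<Rightarrow> real \<Rightarrow> ereal" where
  "alpha_plus X F \<mu> r =
     (SUP f\<in>pclosure X F. SUP m\<in>Med X \<mu> f. ereal (measure \<mu> {x\<in>X. m + r \<le> f x}))"

definition alpha_minus :: "'a set \<Rightarrow> ('a \<Rightarrow> real) set \<Rightarrow> 'a measure \<Rightarrow> real \<Rightarrow> ereal" where
  "alpha_minus X F \<mu> r =
     (SUP f\<in>pclosure X F. SUP m\<in>Med X \<mu> f. ereal (measure \<mu> {x\<in>X. f x \<le> m - r}))"

end

theory Submission
  imports Defs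
begin

text \<open>
  For each \<open>f\<close> in the pointwise closure everything reduces to the push-forward of \<open>\<mu>\<close> on the real
  line.  The upper bounds (i) and (iii) come from exhibiting an interval between two quantiles,
  respectively around a median.  The lower bounds (ii) and (iv) come from the fact that a
  set of measure at least \<open>1 - \<kappa>\<close> meets every set of measure greater than \<open>\<kappa>\<close>: it therefore
  contains values of \<open>f\<close> from both of two sets that \<open>f\<close> separates.
\<close>

section \<open>Quantiles of a distribution on the real line\<close>

lemma (in real_distribution) quantile_exists:
  assumes "0 < p" "p < 1"
  shows "\<exists>q. p \<le> measure M {..q} \<and> measure M {..<q} \<le> p"
proof -
  define S where "S = {t. p \<le> cdf M t}"
  have "\<forall>\<^sub>F t in at_top. p < cdf M t"
    using order_tendstoD(1)[OF cdf_lim_at_top_prob assms(2)] .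
  then obtain u where "p < cdf M u"
    by (auto simp: eventually_at_top_linorder)
  then have ne: "S \<noteq> {}"
    by (auto simp: S_def intro: less_imp_le)
  have "\<forall>\<^sub>F t in at_bot. cdf M t < p"
    using order_tendstoD(2)[OF cdf_lim_at_bot assms(1)] .
  then obtain l where l: "\<And>t. t \<le> l \<Longrightarrow> cdf M t < p"
    by (auto simp: eventually_at_bot_linorder)
  have bdd: "bdd_below S"
  proof (rule bdd_belowI)
    fix t assume "t \<in> S"
    then show "l \<le> t"
      using l[of t] unfolding S_def by (cases "t \<le> l") auto
  qed
  \<comment> \<open>\<open>q\<close> is the generalised inverse of the cdf at \<open>p\<close>.
    Right continuity carries the lower bound over to \<open>q\<close> itself, whereas an atom at
    \<open>q\<close> can lift \<open>cdf M q\<close> above \<open>p\<close>; so the upper bound is a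
    left limit and concerns the open ray \<open>{..<q}\<close>.\<close>
  define q where "q = Inf S"
  have above: "p \<le> cdf M t" if t: "q < t" for t
  proof -
    obtain s where "s \<in> S" "s < t"
      using t ne bdd cInf_lessD unfolding q_def by blast
    then show ?thesis
      using cdf_nondecreasing[of s t] by (simp add: S_def)
  qed
  have below: "cdf M t \<le> p" if "t < q" for t
  proof -
    have "t \<notin> S"
      using that cInf_lower[OF _ bdd, of t] by (auto simp: q_def)
    then show ?thesis
      by (simp add: S_def)
  qed
  have "(cdf M \<longlongrightarrow> cdf M q) (at_right q)"
    using cdf_is_right_cont[of q] by (simp add: continuous_within)
  then have "p \<le> cdf M q"
    by (rule tendsto_lowerbound) (auto simp: eventually_at_filter above)
  moreover have "measure M {..<q} \<le> p"
    by (rule tendsto_upperbound[OF cdf_at_left])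
       (auto simp: eventually_at_filter below)
  ultimately show ?thesis
    by (auto simp: cdf_def)
qed

section \<open>Diameters and partial diameters\<close>

lemma ediam_upper: "x \<in> B \<Longrightarrow> y \<in> B \<Longrightarrow> ereal \<bar>x - y\<bar> \<le> ediam B"
  unfolding ediam_def Sup0_def by (auto intro!: Sup_upper)

lemma ediam_nonneg: "0 \<le> ediam B"
proof (cases "B = {}")
  case True
  then show ?thesis by (simp add: ediam_def Sup0_def)
next
  case False
  then obtain x where "x \<in> B" by blast
  then show ?thesis
    using ediam_upper[of x B x] by (simp add: zero_ereal_def)
qed

text \<open>The hypothesis \<open>a \<le> b\<close> covers empty \<open>B\<close>, whose
  \<open>ediam\<close> is 0 by the convention in \<open>Sup0\<close>.\<close>

lemma ediam_subset_Icc: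
  assumes "B \<subseteq> {a..b}" "a \<le> b"
  shows "ediam B \<le> ereal (b - a)"
proof -
  have "\<bar>x - y\<bar> \<le> b - a" if "x \<in> B" "y \<in> B" for x y
    using that assms by (auto simp: subset_iff abs_le_iff) (smt (verit))+
  then show ?thesis
    using assms(2) by (auto simp: ediam_def Sup0_def intro!: Sup_least)
qed

lemma PartDiam_nonneg: "0 \<le> PartDiam \<nu> \<alpha>"
  unfolding PartDiam_def by (auto intro!: INF_greatest ediam_nonneg)

lemma PartDiam_le_Icc:
  assumes "B \<in> sets borel" "\<alpha> \<le> measure \<nu> B" "B \<subseteq> {a..b}" "a \<le> b"
  shows "PartDiam \<nu> \<alpha> \<le> ereal (b - a)"
  unfolding PartDiam_def
  using assms by (intro INF_lower2[of B] ediam_subset_Icc) auto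

text \<open>Common source of the lower bounds (ii) and (iv). The bound \<open>c\<close> is an
  extended real so that an infimum of differences can be inserted for it directly.\<close>

lemma (in prob_space) PartDiam_distr_ge:
  assumes f: "f \<in> borel_measurable M"
    and A: "A0 \<in> sets M" "A1 \<in> sets M" "\<kappa> < prob A0" "\<kappa> < prob A1"
    and sep: "\<And>x y. x \<in> A0 \<Longrightarrow> y \<in> A1 \<Longrightarrow> c \<le> ereal (f y - f x)"
  shows "c \<le> PartDiam (distr M borel f) (1 - \<kappa>)"
  unfolding PartDiam_def
proof (rule INF_greatest)
  fix B assume "B \<in> {B \<in> sets borel. 1 - \<kappa> \<le> measure (distr M borel f) B}"
  then have B: "B \<in> sets borel" and "1 - \<kappa> \<le> prob (f -` B \<inter> space M)"
    using f by (auto simp: measure_distr)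
  have hit: "\<exists>x\<in>A. f x \<in> B" if "A \<in> sets M" "\<kappa> < prob A" for A
  proof (rule ccontr)
    assume "\<not> (\<exists>x\<in>A. f x \<in> B)"
    \<comment> \<open>Two disjoint sets of mass greater than \<open>\<kappa>\<close> and at least
      \<open>1 - \<kappa>\<close> would have total mass above 1; the strict bound on
      \<open>A\<close> is essential.\<close>
    then have "prob (A \<union> (f -` B \<inter> space M)) = prob A + prob (f -` B \<inter> space M)"
      using that B f by (intro finite_measure_Union measurable_sets) auto
    then show False
      using that \<open>1 - \<kappa> \<le> _\<close> prob_le_1[of "A \<union> (f -` B \<inter> space M)"] by linarith
  qed
  obtain x y where "x \<in> A0" "f x \<in> B" "y \<in> A1" "f y \<in> B"
    using hit[OF A(1,3)] hit[OF A(2,4)] by blast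
  then have "c \<le> ereal (f y - f x)" "ereal \<bar>f y - f x\<bar> \<le> ediam B"
    using sep ediam_upper by blast+
  then show "c \<le> ediam B"
    by (metis abs_ge_self ereal_less_eq(3) order_trans)
qed

section \<open>The pointwise closure of the function family\<close>

lemma pclosure_nonempty:
  assumes "gd_set X F \<mu>"
  shows "pclosure X F \<noteq> {}"
proof -
  have "F \<subseteq> topspace (powertop_real X)" "F \<noteq> {}"
    using assms by (auto simp: gd_set_def)
  then show ?thesis
    using closure_of_subset[of F "powertop_real X"] unfolding pclosure_def by blast
qed

text \<open>For fixed \<open>x\<close> and \<open>y\<close> the bound is a closed condition in the
  product topology, since evaluation at a point is continuous. It holds on \<open>F\<close> by the
  choice of \<open>gd_dist\<close>, hence on the closure.\<close>

lemma pclosure_lipschitz: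
  assumes gd: "gd_set X F \<mu>" and f: "f \<in> pclosure X F" and xy: "x \<in> X" "y \<in> X"
  shows "\<bar>f x - f y\<bar> \<le> gd_dist X F x y"
proof -
  let ?T = "powertop_real X"
  have "continuous_map ?T euclideanreal (\<lambda>g. \<bar>g x - g y\<bar>)"
    using xy by (intro continuous_intros continuous_map_product_projection)
  then have "closedin ?T {g \<in> topspace ?T. \<bar>g x - g y\<bar> \<in> {..gd_dist X F x y}}"
    by (rule closedin_continuous_map_preimage) simp
  moreover have "F \<subseteq> {g \<in> topspace ?T. \<bar>g x - g y\<bar> \<in> {..gd_dist X F x y}}"
  proof
    fix g assume "g \<in> F"
    then have "g \<in> X \<rightarrow>\<^sub>E UNIV" "\<bar>g x - g y\<bar> \<le> gd_dist X F x y"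
      using gd xy unfolding gd_set_def gd_dist_def by (auto intro: cSUP_upper)
    then show "g \<in> {g \<in> topspace ?T. \<bar>g x - g y\<bar> \<in> {..gd_dist X F x y}}"
      by simp
  qed
  ultimately have "pclosure X F \<subseteq> {g \<in> topspace ?T. \<bar>g x - g y\<bar> \<in> {..gd_dist X F x y}}"
    unfolding pclosure_def by (rule closure_of_minimal[rotated])
  then show ?thesis
    using f by auto
qed

lemma pclosure_measurable:
  assumes gd: "gd_set X F \<mu>" and f: "f \<in> pclosure X F"
  shows "f \<in> borel_measurable \<mu>"
proof (rule borel_measurableI)
  interpret Metric_space X "gd_dist X F"
    using gd by (simp add: gd_set_def)
  have sp: "space \<mu> = X" and sets: "sets \<mu> = sigma_sets X {U. openin mtopology U}"
    using gd by (auto simp: gd_set_def)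
  fix S :: "real set" assume S: "open S"
  have "openin mtopology (f -` S \<inter> X)"
    unfolding openin_mtopology
  proof (intro conjI allI impI)
    fix x assume x: "x \<in> f -` S \<inter> X"
    then obtain e where e: "0 < e" "\<And>z. \<bar>z - f x\<bar> < e \<Longrightarrow> z \<in> S"
      using S by (auto simp: open_dist dist_real_def)
    \<comment> \<open>The radius \<open>e\<close> can be kept because the Lipschitz constant is
      1.\<close>
    have "y \<in> f -` S \<inter> X" if "y \<in> mball x e" for y
      using that pclosure_lipschitz[OF gd f, of x y] e(2)[of "f y"] by auto
    then show "\<exists>r>0. mball x r \<subseteq> f -` S \<inter> X"
      using e(1) by blast
  qed simp
  then show "f -` S \<inter> space \<mu> \<in> sets \<mu>"
    by (auto simp: sp sets)
qed

section \<open>Level sets and push-forwards for a fixed gd-set\<close>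

context
  fixes X :: "'a set" and F :: "('a \<Rightarrow> real) set" and \<mu> :: "'a measure"
  assumes gd: "gd_set X F \<mu>"
begin

interpretation prob_space \<mu>
  using gd by (simp add: gd_set_def)

lemma space_eq: "space \<mu> = X"
  using gd by (simp add: gd_set_def)

lemma level_set_sets:
  assumes "f \<in> pclosure X F" "S \<in> sets borel"
  shows "{x\<in>X. f x \<in> S} \<in> sets \<mu>"
proof -
  have "{x\<in>X. f x \<in> S} = f -` S \<inter> space \<mu>"
    by (auto simp: space_eq)
  then show ?thesis
    using pclosure_measurable[OF gd assms(1)] assms(2) by (simp add: measurable_sets)
qed

lemma level_sets:
  assumes "f \<in> pclosure X F"
  shows "{x\<in>X. f x \<le> c} \<in> sets \<mu>" "{x\<in>X. c \<le> f x} \<in> sets \<mu>"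
  using level_set_sets[OF assms, of "{..c}"] level_set_sets[OF assms, of "{c..}"] by auto

lemma measure_distr_eq:
  assumes "f \<in> pclosure X F" "S \<in> sets borel"
  shows "measure (distr \<mu> borel f) S = prob {x\<in>X. f x \<in> S}"
  using pclosure_measurable[OF gd assms(1)] assms(2)
  by (simp add: measure_distr space_eq vimage_def Int_def conj_commute)

lemma measure_distr_pclosure_Compl:
  assumes "f \<in> pclosure X F" "S \<in> sets borel"
  shows "measure (distr \<mu> borel f) (- S) = 1 - measure (distr \<mu> borel f) S"
proof -
  interpret D: prob_space "distr \<mu> borel f"
    by (rule prob_space_distr[OF pclosure_measurable[OF gd assms(1)]])
  show ?thesis
    using D.prob_compl[of S] assms(2) by (simp add: Compl_eq_Diff_UNIV)
qed

text \<open>Used with \<open>p\<close> equal to \<open>\<kappa>\<close> and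
  \<open>1 - \<kappa>\<close> for (i), and with \<open>p = 1/2\<close> to produce a median.\<close>

lemma pclosure_quantile_exists:
  assumes "f \<in> pclosure X F" "0 < p" "p < 1"
  shows "\<exists>q. p \<le> prob {x\<in>X. f x \<le> q} \<and> 1 - p \<le> prob {x\<in>X. q \<le> f x}"
proof -
  interpret D: real_distribution "distr \<mu> borel f"
    using pclosure_measurable[OF gd assms(1)] by simp
  obtain q where q: "p \<le> measure (distr \<mu> borel f) {..q}" "measure (distr \<mu> borel f) {..<q} \<le> p"
    using D.quantile_exists[OF assms(2,3)] by blast
  have "- {..<q} = {q..}"
    by auto
  then have "1 - p \<le> measure (distr \<mu> borel f) {q..}"
    using measure_distr_pclosure_Compl[OF assms(1), of "{..<q}"] q(2) by simp
  then show ?thesis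
    using q(1) assms(1) by (auto simp: measure_distr_eq)
qed

text \<open>Common source of the upper bounds (i) and (iii). \<open>B\<close> is kept apart from
  \<open>{a..b}\<close> so that it may be the closed interval in (i) and an open one in
  (iii).\<close>

lemma PartDiam_le_of_tails:
  assumes f: "f \<in> pclosure X F" and "B \<in> sets borel" "B \<subseteq> {a..b}" "a \<le> b"
    and tail: "prob {x\<in>X. f x \<notin> B} \<le> \<kappa>"
  shows "PartDiam (distr \<mu> borel f) (1 - \<kappa>) \<le> ereal (b - a)"
proof (rule PartDiam_le_Icc)
  have "measure (distr \<mu> borel f) (- B) \<le> \<kappa>"
    using tail assms by (simp add: measure_distr_eq)
  then show "1 - \<kappa> \<le> measure (distr \<mu> borel f) B"
    using measure_distr_pclosure_Compl[OF f, of B] assms by simp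
qed (use assms in auto)

section \<open>Observable diameter and separation\<close>

lemma directed_sep_level_sets_ge:
  assumes "f \<in> pclosure X F"
  shows "ereal (b - a) \<le> directed_sep X F {x\<in>X. f x \<le> a} {x\<in>X. b \<le> f x}"
  unfolding directed_sep_def
  by (intro SUP_upper2[OF assms] INF_greatest) auto

text \<open>With a \<open>\<kappa>\<close>-quantile \<open>a\<close> and a
  \<open>(1 - \<kappa>)\<close>-quantile \<open>b\<close> of \<open>f\<close>, the interval
  \<open>{a..b}\<close> loses mass at most \<open>\<kappa>\<close> on each side, while the closed
  level sets below \<open>a\<close> and above \<open>b\<close> have mass at least
  \<open>\<kappa>\<close> and so compete in \<open>Sep\<close>.\<close>

lemma ObsDiam_le_Sep_plus:
  assumes "0 < \<kappa>" "\<kappa> < 1/2"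
  shows "ObsDiam X F \<mu> (2 * \<kappa>) \<le> Sep_plus X F \<mu> \<kappa> \<kappa>"
  unfolding ObsDiam_def
proof (rule SUP_least)
  fix f assume f: "f \<in> pclosure X F"
  obtain a where a: "\<kappa> \<le> prob {x\<in>X. f x \<le> a}" "1 - \<kappa> \<le> prob {x\<in>X. a \<le> f x}"
    using pclosure_quantile_exists[OF f, of \<kappa>] assms by auto
  obtain b where b: "1 - \<kappa> \<le> prob {x\<in>X. f x \<le> b}" "\<kappa> \<le> prob {x\<in>X. b \<le> f x}"
    using pclosure_quantile_exists[OF f, of "1 - \<kappa>"] assms by auto
  have compl: "prob {x\<in>X. f x < a} = 1 - prob {x\<in>X. a \<le> f x}"
    "prob {x\<in>X. b < f x} = 1 - prob {x\<in>X. f x \<le> b}"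
    using prob_compl[OF level_sets(2)[OF f, of a]] prob_compl[OF level_sets(1)[OF f, of b]]
    by (simp_all add: space_eq set_diff_eq not_le conj_disj_distribL cong: conj_cong)
  have meas: "{x\<in>X. f x < a} \<in> sets \<mu>" "{x\<in>X. b < f x} \<in> sets \<mu>"
    using level_set_sets[OF f, of "{..<a}"] level_set_sets[OF f, of "{b<..}"] by auto
  have tails: "prob ({x\<in>X. f x < a} \<union> {x\<in>X. b < f x}) \<le> 2 * \<kappa>"
    using measure_Un_le[OF meas] compl a b by linarith
  \<comment> \<open>The quantiles were chosen independently. If \<open>b < a\<close>, the two tails
    would cover \<open>X\<close>, contradicting \<open>2 * \<kappa> < 1\<close>.\<close>
  have "a \<le> b"
  proof (rule ccontr)
    assume "\<not> a \<le> b"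
    then have "{x\<in>X. f x < a} \<union> {x\<in>X. b < f x} = space \<mu>"
      by (auto simp: space_eq)
    then show False
      using tails assms prob_space by simp
  qed
  have "{x\<in>X. f x \<notin> {a..b}} = {x\<in>X. f x < a} \<union> {x\<in>X. b < f x}"
    by auto
  then have le: "PartDiam (distr \<mu> borel f) (1 - 2 * \<kappa>) \<le> ereal (b - a)"
    using tails \<open>a \<le> b\<close> by (intro PartDiam_le_of_tails[OF f, of "{a..b}"]) auto
  show "PartDiam (distr \<mu> borel f) (1 - 2 * \<kappa>) \<le> Sep_plus X F \<mu> \<kappa> \<kappa>"
  \<comment> \<open>For \<open>a = b\<close> the level sets may intersect and thus be inadmissible
    in \<open>Sep\<close>; the bound is then 0, which the maximum in \<open>Sep_plus\<close>
    absorbs.\<close>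
  proof (cases "a = b")
    case True
    then show ?thesis
      using le by (simp add: Sep_plus_def zero_ereal_def[symmetric] le_max_iff_disj)
  next
    case False
    let ?A0 = "{x\<in>X. f x \<le> a}" and ?A1 = "{x\<in>X. b \<le> f x}"
    have "?A0 \<inter> ?A1 = {}"
      using False \<open>a \<le> b\<close> by auto
    then have "directed_sep X F ?A0 ?A1 \<le> Sep X F \<mu> \<kappa> \<kappa>"
      using level_sets[OF f] a b unfolding Sep_def Sup0_def
      by (auto intro!: Sup_upper)
    then have "ereal (b - a) \<le> Sep_plus X F \<mu> \<kappa> \<kappa>"
      using directed_sep_level_sets_ge[OF f, of b a]
      unfolding Sep_plus_def by (meson le_max_iff_disj order_trans)
    then show ?thesis
      using le by (rule order_trans[rotated])
  qed
qed

text \<open>Rests on \<open>pclosure X F\<close> being nonempty: a supremum over no functions would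
  be \<open>-\<infinity>\<close>.\<close>

lemma ObsDiam_nonneg: "0 \<le> ObsDiam X F \<mu> \<kappa>"
  using pclosure_nonempty[OF gd] PartDiam_nonneg
  unfolding ObsDiam_def by (metis SUP_upper2 ex_in_conv)

lemma ObsDiam_ge:
  assumes f: "f \<in> pclosure X F"
    and A: "A0 \<in> sets \<mu>" "A1 \<in> sets \<mu>" "\<kappa> < prob A0" "\<kappa> < prob A1"
    and sep: "\<And>x y. x \<in> A0 \<Longrightarrow> y \<in> A1 \<Longrightarrow> c \<le> ereal (f y - f x)"
  shows "c \<le> ObsDiam X F \<mu> \<kappa>"
proof -
  have "c \<le> PartDiam (distr \<mu> borel f) (1 - \<kappa>)"
    using sep by (intro PartDiam_distr_ge[OF pclosure_measurable[OF gd f] A])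
  then show ?thesis
    unfolding ObsDiam_def by (rule SUP_upper2[OF f])
qed

lemma Sep_plus_le_ObsDiam:
  assumes "\<kappa>' < \<kappa>"
  shows "Sep_plus X F \<mu> \<kappa> \<kappa> \<le> ObsDiam X F \<mu> \<kappa>'"
proof -
  have "directed_sep X F A0 A1 \<le> ObsDiam X F \<mu> \<kappa>'"
    if A: "A0 \<in> sets \<mu>" "A1 \<in> sets \<mu>" "\<kappa> \<le> prob A0" "\<kappa> \<le> prob A1" for A0 A1
    unfolding directed_sep_def
  proof (rule SUP_least)
    fix f assume "f \<in> pclosure X F"
    then show "(INF a\<in>A0. INF b\<in>A1. ereal (f b - f a)) \<le> ObsDiam X F \<mu> \<kappa>'"
      \<comment> \<open>The separation constant is the infimum itself, and
        \<open>\<kappa>' < \<kappa>\<close> turns the mass bounds on \<open>A0\<close> and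
        \<open>A1\<close> into strict ones.\<close>
      using A assms by (intro ObsDiam_ge[of f A0 A1]) (auto intro: INF_lower2)
  qed
  \<comment> \<open>Nonnegativity of \<open>ObsDiam\<close> handles the value 0 that
    \<open>Sup0\<close> takes when no pair is admissible.\<close>
  then have "Sep X F \<mu> \<kappa> \<kappa> \<le> ObsDiam X F \<mu> \<kappa>'"
    unfolding Sep_def Sup0_def by (auto simp: ObsDiam_nonneg intro!: Sup_least)
  then show ?thesis
    using ObsDiam_nonneg by (simp add: Sep_plus_def)
qed

section \<open>Medians and the one-sided concentration functions\<close>

lemma Med_nonempty: "f \<in> pclosure X F \<Longrightarrow> Med X \<mu> f \<noteq> {}"
  using pclosure_quantile_exists[of f "1/2"] by (auto simp: Med_def)

lemma ObsDiam_le_of_alpha: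
  assumes r: "0 < rp" "0 < rm"
    and \<alpha>: "alpha_plus X F \<mu> rp + alpha_minus X F \<mu> rm \<le> ereal \<kappa>"
  shows "ObsDiam X F \<mu> \<kappa> \<le> ereal (rp + rm)"
  unfolding ObsDiam_def
proof (rule SUP_least)
  fix f assume f: "f \<in> pclosure X F"
  then obtain m where m: "m \<in> Med X \<mu> f"
    using Med_nonempty by blast
  let ?P = "{x\<in>X. m + rp \<le> f x}" and ?M = "{x\<in>X. f x \<le> m - rm}"
  have "ereal (prob ?P) \<le> alpha_plus X F \<mu> rp" "ereal (prob ?M) \<le> alpha_minus X F \<mu> rm"
    unfolding alpha_plus_def alpha_minus_def
    by (rule SUP_upper2[OF f], rule SUP_upper[OF m])+
  from order_trans[OF add_mono[OF this] \<alpha>] have "prob ?P + prob ?M \<le> \<kappa>"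
    by simp
  then have "prob (?P \<union> ?M) \<le> \<kappa>"
    using measure_Un_le[OF level_sets(2,1)[OF f], of "m + rp" "m - rm"] by linarith
  \<comment> \<open>The interval is open because \<open>alpha_plus\<close> and
    \<open>alpha_minus\<close> measure closed tails, which then form exactly its complement.\<close>
  moreover have "{x\<in>X. f x \<notin> {m - rm<..<m + rp}} = ?P \<union> ?M"
    by auto
  ultimately have "PartDiam (distr \<mu> borel f) (1 - \<kappa>) \<le> ereal (m + rp - (m - rm))"
    using r by (intro PartDiam_le_of_tails[OF f, of "{m - rm<..<m + rp}"]) auto
  then show "PartDiam (distr \<mu> borel f) (1 - \<kappa>) \<le> ereal (rp + rm)"
    by (simp add: add.commute)
qed

text \<open>The lower bound on \<open>ObsDiam\<close> is available only strictly below the tail mass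
  \<open>\<beta>\<close>, so \<open>\<beta>\<close> is reached by density, without having to be an
  admissible \<open>\<kappa>\<close> itself.\<close>

lemma tail_le_Sup0_ObsDiam:
  assumes "0 \<le> \<beta>" "\<beta> \<le> 1"
    and obs: "\<And>\<kappa>. 0 < \<kappa> \<Longrightarrow> \<kappa> < \<beta> \<Longrightarrow> ereal r \<le> ObsDiam X F \<mu> \<kappa>"
  shows "ereal \<beta> \<le> Sup0 {ereal \<kappa> | \<kappa>. 0 < \<kappa> \<and> \<kappa> < 1 \<and> ereal r \<le> ObsDiam X F \<mu> \<kappa>}"
    (is "_ \<le> Sup0 ?S")
proof -
  have up: "s \<le> Sup0 ?S" if "s \<in> ?S" for s
    using that unfolding Sup0_def by (auto intro: Sup_upper)
  \<comment> \<open>Levels \<open>s \<le> 0\<close> correspond to no admissible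
    \<open>\<kappa>\<close> and rely on this bound instead; for empty \<open>?S\<close> it is the
    convention in \<open>Sup0\<close>.\<close>
  have nonneg: "0 \<le> Sup0 ?S"
  proof (cases "?S = {}")
    case True
    then show ?thesis
      by (simp only: Sup0_def if_True) simp
  next
    case False
    then obtain \<kappa> where "0 < \<kappa>" "ereal \<kappa> \<in> ?S"
      by blast
    then show ?thesis
      using up[of "ereal \<kappa>"] by (meson ereal_less(2) less_imp_le order_trans)
  qed
  show ?thesis
  proof (rule dense_le)
    fix s :: ereal assume s: "s < ereal \<beta>"
    show "s \<le> Sup0 ?S"
    proof (cases "0 < s")
      case True
      with s obtain \<kappa> where "s = ereal \<kappa>" "0 < \<kappa>" "\<kappa> < \<beta>"
        by (cases s) auto
      then show ?thesis
        using obs[of \<kappa>] assms(2) by (intro up) auto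
    next
      case False
      then show ?thesis
        using nonneg by (meson leI order_trans)
    qed
  qed
qed

text \<open>A tail at distance \<open>r\<close> from a median is separated by \<open>f\<close> from
  the opposite half, which has mass at least 1/2. The tail has mass at most 1/2, so any
  \<open>\<kappa>\<close> below the tail mass is below both masses.\<close>

lemma alpha_le_Sup0_ObsDiam:
  assumes r: "0 < r"
  shows "max (alpha_plus X F \<mu> r) (alpha_minus X F \<mu> r)
    \<le> Sup0 {ereal \<kappa> | \<kappa>. 0 < \<kappa> \<and> \<kappa> < 1 \<and> ereal r \<le> ObsDiam X F \<mu> \<kappa>}"
    (is "_ \<le> ?R")
proof -
  have "ereal (prob {x\<in>X. m + r \<le> f x}) \<le> ?R \<and> ereal (prob {x\<in>X. f x \<le> m - r}) \<le> ?R"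
    if f: "f \<in> pclosure X F" and m: "m \<in> Med X \<mu> f" for f m
  proof -
    let ?L = "{x\<in>X. f x \<le> m}" and ?U = "{x\<in>X. m \<le> f x}"
    let ?P = "{x\<in>X. m + r \<le> f x}" and ?M = "{x\<in>X. f x \<le> m - r}"
    note [simp] = level_sets[OF f]
    have med: "1/2 \<le> prob ?L" "1/2 \<le> prob ?U"
      using m by (auto simp: Med_def)
    \<comment> \<open>Disjointness comes from \<open>0 < r\<close>; total mass at most 1 then bounds
      each tail by 1/2.\<close>
    have "prob (?P \<union> ?L) = prob ?P + prob ?L" "prob (?M \<union> ?U) = prob ?M + prob ?U"
      using r by (auto intro!: finite_measure_Union)
    then have half: "prob ?P \<le> 1/2" "prob ?M \<le> 1/2"
      using med prob_le_1[of "?P \<union> ?L"] prob_le_1[of "?M \<union> ?U"] by linarith+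
    have "ereal r \<le> ObsDiam X F \<mu> \<kappa>" if "\<kappa> < prob ?P" for \<kappa>
      using that med half by (intro ObsDiam_ge[OF f, of ?L ?P]) auto
    \<comment> \<open>Here the tail is the lower set and the half the upper one, so \<open>f\<close>
      itself serves again and \<open>-f\<close> need not lie in the closure.\<close>
    moreover have "ereal r \<le> ObsDiam X F \<mu> \<kappa>" if "\<kappa> < prob ?M" for \<kappa>
      using that med half by (intro ObsDiam_ge[OF f, of ?M ?U]) auto
    ultimately show ?thesis
      by (auto intro!: tail_le_Sup0_ObsDiam)
  qed
  then show ?thesis
    unfolding alpha_plus_def alpha_minus_def by (intro max.boundedI SUP_least) blast+
qed

end

theorem theorem5p4:
  fixes X :: "'a set" and F :: "('a \<Rightarrow> real) set" and \<mu> :: "'a measure"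
  assumes "gd_set X F \<mu>"
  shows "(\<forall>\<kappa>::real. 0 < \<kappa> \<and> \<kappa> < 1/2 \<longrightarrow> ObsDiam X F \<mu> (2 * \<kappa>) \<le> Sep_plus X F \<mu> \<kappa> \<kappa>) \<and>
    (\<forall>\<kappa>' \<kappa>::real. 0 < \<kappa>' \<and> \<kappa>' < \<kappa> \<and> \<kappa> \<le> 1/2 \<longrightarrow>
       Sep_plus X F \<mu> \<kappa> \<kappa> \<le> ObsDiam X F \<mu> \<kappa>') \<and>
    (\<forall>\<kappa> rp rm::real. 0 < \<kappa> \<and> \<kappa> < 1 \<and> 0 < rp \<and> 0 < rm \<and>
       alpha_plus X F \<mu> rp + alpha_minus X F \<mu> rm \<le> ereal \<kappa> \<longrightarrow>
       ObsDiam X F \<mu> \<kappa> \<le> ereal (rp + rm)) \<and>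
    (\<forall>r::real. 0 < r \<longrightarrow>
       max (alpha_plus X F \<mu> r) (alpha_minus X F \<mu> r)
         \<le> Sup0 {ereal \<kappa> | \<kappa>. 0 < \<kappa> \<and> \<kappa> < 1 \<and> ereal r \<le> ObsDiam X F \<mu> \<kappa>})"
  using ObsDiam_le_Sep_plus[OF assms] Sep_plus_le_ObsDiam[OF assms]
    ObsDiam_le_of_alpha[OF assms] alpha_le_Sup0_ObsDiam[OF assms]
  by blast

end
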